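(* Let $\beta,\gamma>0$ and $x,y\in(0,1)$, and put $$U=\frac{\beta x+\gamma y}{\beta+\gamma},\qquad V=\frac{\beta x+\gamma(1-y)}{\beta+\gamma}.$$ Assume $U,V\in(0,1)$. Then $$\sin^{\beta}(\pi x)\,\sin^{\gamma}(\pi y)\leq\min\bigl\{\sin^{\beta+\gamma}(\pi U),\ \sin^{\beta+\gamma}(\pi V)\bigr\}.$$ Moreover, $$\sin(\pi U)\geq\sin(\pi V)\iff(1-2y)(2x-1)\geq0.$$
   Context: Here $\sin^{c}(t)$ denotes $(\sin t)^c$. *)

theory Defs
  imports Complex_Main
begin

end

theory Submission
  imports Defs "HOL-Analysis.Convex"
begin

text \<open>
  The inequality is Jensen's inequality for the concave function \<open>ln \<circ> sin\<close> on \<open>(0, \<pi>)\<close>; the bound by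
  \<open>V\<close> is the bound by \<open>U\<close> for \<open>1 - y\<close> in place of \<open>y\<close>, because \<open>sin (\<pi> (1 - y)) = sin (\<pi> y)\<close>.
  For the equivalence, \<open>sin (\<pi> t)\<close> is a strictly decreasing function of \<open>\<bar>t - 1/2\<bar>\<close>, and \<open>U - 1/2\<close>,
  \<open>V - 1/2\<close> are proportional to \<open>a + b\<close>, \<open>a - b\<close> with \<open>a = \<beta> (x - 1/2)\<close>, \<open>b = \<gamma> (y - 1/2)\<close>; finally
  \<open>(a + b)\<^sup>2 \<le> (a - b)\<^sup>2\<close> means \<open>a b \<le> 0\<close>.
\<close>

text \<open>The first derivative is \<open>cot\<close>, and the second, -1/sin^2, is
  negative.\<close>

lemma concave_on_ln_sin: "concave_on {0<..<pi} (\<lambda>t. ln (sin t))"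
proof (rule f''_le0_imp_concave)
  fix t :: real
  assume "t \<in> {0<..<pi}"
  then have "sin t > 0"
    by (simp add: sin_gt_zero)
  then show "((\<lambda>t. ln (sin t)) has_real_derivative cot t) (at t)"
    by (auto intro!: derivative_eq_intros simp: cot_def)
  show "(cot has_real_derivative - inverse ((sin t)\<^sup>2)) (at t)"
    using \<open>sin t > 0\<close> by (simp add: DERIV_cot)
qed auto

text \<open>Weighted Jensen with weights \<beta>/(\<beta>+\<gamma>) and \<gamma>/(\<beta>+\<gamma>),
  scaled by \<beta>+\<gamma> and exponentiated.\<close>

lemma sin_powr_mult_le:
  fixes \<beta> \<gamma> s t :: real
  assumes "\<beta> > 0" "\<gamma> > 0" and s: "s \<in> {0<..<pi}" and t: "t \<in> {0<..<pi}"
  shows "sin s powr \<beta> * sin t powr \<gamma> \<le> sin ((\<beta> * s + \<gamma> * t) / (\<beta> + \<gamma>)) powr (\<beta> + \<gamma>)"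
proof -
  define u v where "u = \<beta> / (\<beta> + \<gamma>)" and "v = \<gamma> / (\<beta> + \<gamma>)"
  have uv: "u \<ge> 0" "v \<ge> 0" "u + v = 1"
    using assms by (auto simp: u_def v_def add_divide_distrib[symmetric])
  have \<beta>: "\<beta> = (\<beta> + \<gamma>) * u" and \<gamma>: "\<gamma> = (\<beta> + \<gamma>) * v"
    using assms by (auto simp: u_def v_def)
  define w where "w = u * s + v * t"
  have w: "(\<beta> * s + \<gamma> * t) / (\<beta> + \<gamma>) = w"
    by (simp add: w_def u_def v_def add_divide_distrib)
  have "w \<in> {0<..<pi}"
    using convexD[OF convex_real_interval(8) s t uv] by (simp add: w_def)
  then have pos: "sin s > 0" "sin t > 0" "sin w > 0"
    using s t by (auto intro: sin_gt_zero)
  have "u * ln (sin s) + v * ln (sin t) \<le> ln (sin w)"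
    using concave_on_ln_sin s t uv by (auto simp: concave_on_iff w_def)
  then have "(\<beta> + \<gamma>) * (u * ln (sin s) + v * ln (sin t)) \<le> (\<beta> + \<gamma>) * ln (sin w)"
    using assms by (intro mult_left_mono) auto
  then have "\<beta> * ln (sin s) + \<gamma> * ln (sin t) \<le> (\<beta> + \<gamma>) * ln (sin w)"
    using \<beta> \<gamma> by (metis distrib_left mult.assoc)
  \<comment> \<open>All three sines are positive, so each \<open>powr\<close> unfolds to
    \<open>exp\<close> of an exponent times \<open>ln\<close>.\<close>
  then show ?thesis
    using pos by (simp add: w powr_def flip: exp_add)
qed

lemma sin_pi_one_minus: "sin (pi * (1 - t)) = sin (pi * t)"
  by (simp add: right_diff_distrib)

text \<open>A shift by pi/2 turns sine into cosine, and evenness of cosine allows the absolute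
  value.\<close>

lemma sin_pi_eq_cos: "sin (pi * t) = cos (pi * \<bar>t - 1/2\<bar>)"
proof -
  have "cos (pi * \<bar>t - 1/2\<bar>) = cos (pi * t - pi / 2)"
    by (cases "t \<ge> 1/2") (simp_all add: right_diff_distrib flip: cos_minus[of "pi * t - pi / 2"])
  then show ?thesis
    by (simp add: cos_diff)
qed

lemma sin_pi_le_iff:
  fixes s t :: real
  assumes "s \<in> {0..1}" "t \<in> {0..1}"
  shows "sin (pi * s) \<le> sin (pi * t) \<longleftrightarrow> \<bar>t - 1/2\<bar> \<le> \<bar>s - 1/2\<bar>"
proof -
  \<comment> \<open>Both arguments of \<open>cos\<close> thus lie in [0, pi], where it is strictly
    decreasing.\<close>
  have "pi * \<bar>s - 1/2\<bar> \<le> pi * 1" "pi * \<bar>t - 1/2\<bar> \<le> pi * 1"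
    using assms by (intro mult_left_mono; auto simp: abs_le_iff)+
  then show ?thesis
    by (simp add: sin_pi_eq_cos cos_mono_le_eq)
qed

theorem corollary4p1:
  fixes \<beta> \<gamma> x y U V :: real
  assumes "\<beta> > 0" and "\<gamma> > 0"
    and "x \<in> {0<..<1}" and "y \<in> {0<..<1}"
    and "U = (\<beta> * x + \<gamma> * y) / (\<beta> + \<gamma>)"
    and "V = (\<beta> * x + \<gamma> * (1 - y)) / (\<beta> + \<gamma>)"
    and "U \<in> {0<..<1}" and "V \<in> {0<..<1}"
  shows "sin (pi * x) powr \<beta> * sin (pi * y) powr \<gamma>
           \<le> min (sin (pi * U) powr (\<beta> + \<gamma>)) (sin (pi * V) powr (\<beta> + \<gamma>))
       \<and> (sin (pi * U) \<ge> sin (pi * V) \<longleftrightarrow> (1 - 2 * y) * (2 * x - 1) \<ge> 0)"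
proof -
  have bound: "sin (pi * x) powr \<beta> * sin (pi * z) powr \<gamma>
      \<le> sin (pi * ((\<beta> * x + \<gamma> * z) / (\<beta> + \<gamma>))) powr (\<beta> + \<gamma>)" if "z \<in> {0<..<1}" for z
    using sin_powr_mult_le[of \<beta> \<gamma> "pi * x" "pi * z"] assms(1-3) that
    by (simp add: distrib_left mult.left_commute)
  have U: "sin (pi * x) powr \<beta> * sin (pi * y) powr \<gamma> \<le> sin (pi * U) powr (\<beta> + \<gamma>)"
    using bound[of y] assms by simp
  have V: "sin (pi * x) powr \<beta> * sin (pi * y) powr \<gamma> \<le> sin (pi * V) powr (\<beta> + \<gamma>)"
    using bound[of "1 - y"] assms by (simp add: sin_pi_one_minus)
  define a b where "a = \<beta> * (x - 1/2)" and "b = \<gamma> * (y - 1/2)"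
  have UV: "U - 1/2 = (a + b) / (\<beta> + \<gamma>)" "V - 1/2 = (a - b) / (\<beta> + \<gamma>)"
    using assms(1,2) unfolding assms(5,6) a_def b_def by (simp_all add: field_simps)
  have "sin (pi * U) \<ge> sin (pi * V) \<longleftrightarrow> \<bar>U - 1/2\<bar> \<le> \<bar>V - 1/2\<bar>"
    using assms by (intro sin_pi_le_iff) auto
  also have "\<dots> \<longleftrightarrow> \<bar>a + b\<bar> \<le> \<bar>a - b\<bar>"
    using assms(1,2) unfolding UV by (simp add: divide_le_cancel)
  \<comment> \<open>After squaring, the two sides differ by 4ab.\<close>
  also have "\<dots> \<longleftrightarrow> a * b \<le> 0"
    by (simp add: abs_le_square_iff power2_eq_square algebra_simps)
  \<comment> \<open>Each centred factor gives 1/2; the minus sign comes from y - 1/2 = -(1 - 2y)/2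
    and reverses the inequality.\<close>
  also have "a * b = - (\<beta> * \<gamma> / 4) * ((1 - 2 * y) * (2 * x - 1))"
    by (simp add: a_def b_def field_simps)
  also have "\<dots> \<le> 0 \<longleftrightarrow> (1 - 2 * y) * (2 * x - 1) \<ge> 0"
    using assms(1,2) by (auto simp: mult_le_0_iff zero_le_mult_iff)
  finally show ?thesis
    using U V by simp
qed

end
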